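(* Let $L=[\hat 0,\hat 1]$ be a finite lattice with $L\setminus\{\hat 0,\hat 1\}\neq\emptyset$, let $C$ be any crosscut of $L$, and let $\trianglelefteq$ be any partial ordering relation on $C$ (with strict part $\vartriangleleft$). Let $\mathscr{B}$ be the set of all non-empty subsets $B$ of $C$ such that for any $b\in B$ there is some $c\in C$ satisfying $$c\vartriangleleft b\quad\text{and}\quad \bigwedge B<c<\bigvee B.$$ Then $$\mu(L)=\sum_{\substack{A\subseteq C\\ \bigwedge A=\hat 0,\ \bigvee A=\hat 1\\ \forall B\in\mathscr{B}:\,B\not\subseteq A}} (-1)^{|A|}.$$ Furthermore, the identity remains valid if $\mathscr{B}$ is replaced by any subset $\mathscr{B}'\subseteq\mathscr{B}$.
   Context: $\hat 0$ and $\hat 1$ denote the least and greatest elements of $L$. The symbols $<$, $\bigwedge$, $\bigvee$ refer to the lattice ordering $\le$ of $L$, with $\bigwedge\emptyset=\hat 1$ and $\bigvee\emptyset=\hat 0$; the ordering $\trianglelefteq$ on $C$ is an additional partial order unrelated to $\le$. The Möbius function of $L$ is the unique function $\mu_L:L\to\mathbb{Z}$ such that $\sum_{y\le x}\mu_L(y)=\delta_{\hat 0x}$ for every $x\in L$ (Kronecker delta), and $\mu(L):=\mu_L(\hat 1)$. A crosscut of $L$ is an antichain $C\subseteq L\setminus\{\hat 0,\hat 1\}$ having non-empty intersection with every maximal chain from $\hat 0$ to $\hat 1$ in $L$. *)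

theory Defs
  imports Main
begin

text \<open>
  The lattice \<open>L\<close> is the universe of a type of class \<open>{finite, complete_lattice}\<close>: every finite
  lattice with a least and a greatest element is complete, so nothing is lost, and the library
  supplies \<open>Inf {} = top\<close> and \<open>Sup {} = bot\<close>.
\<close>

definition mobius :: "'a::{finite, order_bot} \<Rightarrow> int" where
  "mobius = (THE m. \<forall>x. (\<Sum>y | y \<le> x. m y) = (if x = bot then 1 else 0))"

lemma ex1_mobius:
  "\<exists>!m :: 'a::{finite, order_bot} \<Rightarrow> int.
     \<forall>x. (\<Sum>y | y \<le> x. m y) = (if x = bot then 1 else 0)"
proof -
  define d :: "'a \<Rightarrow> int" where "d x = (if x = bot then 1 else 0)" for x
  have split: "(\<Sum>y | y \<le> x. m y) = m x + (\<Sum>y | y < x. m y)" for m :: "'a \<Rightarrow> int" and x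
  proof -
    have "{y. y \<le> x} = insert x {y. y < x}" by auto
    then show ?thesis by simp
  qed
  define R :: "('a \<times> 'a) set" where "R = {(y, x). y < x}"
  have wf: "wf R"
    by (rule wf_subset[of "measure (\<lambda>x. card {y. y < x})"])
       (auto simp: R_def intro!: psubset_card_mono)
  define f where "f = wfrec R (\<lambda>g x. d x - (\<Sum>y | y < x. g y))"
  have rec: "f x = d x - (\<Sum>y | y < x. f y)" for x
    unfolding f_def by (subst wfrec[OF wf]) (simp add: R_def cut_apply)
  show ?thesis
    unfolding d_def[symmetric]
  proof (rule ex1I[of _ f])
    show "\<forall>x. (\<Sum>y | y \<le> x. f y) = d x"
    proof
      fix x
      show "(\<Sum>y | y \<le> x. f y) = d x"
        unfolding split using rec[of x] by linarith
    qed
  next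
    fix m :: "'a \<Rightarrow> int"
    assume m: "\<forall>x. (\<Sum>y | y \<le> x. m y) = d x"
    have "m x = f x" for x
      using wf
    proof (induction x rule: wf_induct_rule)
      case (less x)
      have "m x = d x - (\<Sum>y | y < x. m y)"
        using m split[of m x] by (simp add: algebra_simps)
      also have "(\<Sum>y | y < x. m y) = (\<Sum>y | y < x. f y)"
        by (rule sum.cong) (auto simp: less R_def)
      finally show ?case using rec[of x] by linarith
    qed
    then show "m = f" by blast
  qed
qed

lemma sum_mobius:
  "(\<Sum>y | y \<le> x. mobius y) = (if x = (bot :: 'a::{finite, order_bot}) then 1 else 0)"
  using theI'[OF ex1_mobius] unfolding mobius_def by blast

definition antichain :: "'a::order set \<Rightarrow> bool" where
  "antichain C \<longleftrightarrow> (\<forall>x\<in>C. \<forall>y\<in>C. x \<noteq> y \<longrightarrow> \<not> x \<le> y)"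

text \<open>A maximal chain of the whole lattice automatically runs from \<open>bot\<close> to \<open>top\<close>.\<close>

lemma bot_top_in_maxchain:
  fixes K :: "'a::{order_bot, order_top} set"
  assumes "pred_on.maxchain UNIV (<) K"
  shows "bot \<in> K" and "top \<in> K"
proof -
  have chain_iff: "pred_on.chain UNIV (<) S \<longleftrightarrow> (\<forall>x\<in>S. \<forall>y\<in>S. x \<le> y \<or> y \<le> x)" for S :: "'a set"
    unfolding pred_on.chain_def by (simp add: le_less[where 'a = 'a])
  have K: "\<forall>x\<in>K. \<forall>y\<in>K. x \<le> y \<or> y \<le> x"
    and maximal: "\<not> (pred_on.chain UNIV (<) S \<and> K \<subset> S)" for S
    using assms unfolding pred_on.maxchain_def chain_iff by blast+
  have "pred_on.chain UNIV (<) (insert bot K)" "pred_on.chain UNIV (<) (insert top K)"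
    unfolding chain_iff using K by simp_all
  then show "bot \<in> K" and "top \<in> K"
    using maximal by blast+
qed

definition crosscut :: "'a::bounded_lattice set \<Rightarrow> bool" where
  "crosscut C \<longleftrightarrow> antichain C \<and> C \<subseteq> UNIV - {bot, top} \<and>
     (\<forall>K. pred_on.maxchain UNIV (<) K \<longrightarrow> C \<inter> K \<noteq> {})"

text \<open>
  \<open>broken_sets C r\<close> is the family \<open>\<B>\<close>; the relation \<open>r\<close> is the reflexive ordering on \<open>C\<close>,
  with strict part \<open>r - Id\<close>.
\<close>

definition broken_sets :: "'a::complete_lattice set \<Rightarrow> ('a \<times> 'a) set \<Rightarrow> 'a set set" where
  "broken_sets C r = {B. B \<noteq> {} \<and> B \<subseteq> C \<and>
     (\<forall>b\<in>B. \<exists>c\<in>C. (c, b) \<in> r - Id \<and> Inf B < c \<and> c < Sup B)}"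

end

theory Submission
  imports Defs
begin

text \<open>
  The case of an empty family is Rota's crosscut theorem: \<open>mobius top\<close> is the sum of
  \<open>(-1) ^ card A\<close> over the spanning subsets \<open>A\<close> of \<open>C\<close>, those with \<open>Inf A = bot\<close> and
  \<open>Sup A = top\<close>.  For its proof, \<open>mobius\<close> turns the indicator of \<open>Inf A = bot\<close> into a sum over
  the lower bounds \<open>y\<close> of \<open>A\<close>, and the Moebius function of the reversed order turns the indicator
  of \<open>Sup A = top\<close> into a sum over the upper bounds \<open>z\<close>.  After exchanging summations, the inner
  sum runs over all subsets of \<open>C \<inter> {y..z}\<close>, so it is \<open>1\<close> if that set is empty and \<open>0\<close> otherwise.
  The weights of all pairs \<open>(y, z)\<close> sum to \<open>0\<close> since \<open>bot \<noteq> top\<close>, so only the pairs with an element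
  of \<open>C\<close> between \<open>y\<close> and \<open>z\<close> remain, with the opposite sign.
  For \<open>y \<le> z\<close>, a maximal chain through \<open>y\<close> and \<open>z\<close> meets \<open>C\<close>, and it does so below \<open>y\<close>, between
  \<open>y\<close> and \<open>z\<close>, or above \<open>z\<close>; as \<open>C\<close> is an antichain, exactly one of these three happens for each
  such pair.  Summing over \<open>y\<close> first leaves only \<open>z = bot\<close>, and summing over \<open>z\<close> first leaves only
  \<open>y = top\<close>; since \<open>C\<close> has elements above \<open>bot\<close> and below \<open>top\<close>, the terms at \<open>z = bot\<close> cancel and
  those at \<open>y = top\<close> yield \<open>mobius top\<close>.

  It remains to see that the spanning sets \<open>A\<close> that contain a member of \<open>\<B>'\<close> cancel.
  If \<open>B \<subseteq> A\<close> with \<open>B \<in> \<B>'\<close>, then an element \<open>c\<close> strictly between \<open>Inf B\<close> and \<open>Sup B\<close> can be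
  inserted into or removed from \<open>A\<close> without affecting \<open>Inf A\<close> and \<open>Sup A\<close>, provided that \<open>c \<notin> B\<close>.
  The partial order on \<open>C\<close> provides such a \<open>c\<close> that is smaller in rank than all of \<open>B\<close>.  Toggling
  a \<open>c\<close> of largest rank among all that arise from members of \<open>\<B>'\<close> inside \<open>A\<close> is an
  involution: the members of \<open>\<B>'\<close> that appear or disappear contain \<open>c\<close>, so they only give rise
  to elements of smaller rank.
\<close>

section \<open>Sign-reversing toggles\<close>

lemma power_minus_one_card_toggle:
  assumes "finite A"
  shows "(-1 :: int) ^ card (sym_diff A {c}) = - ((-1) ^ card A)"
proof (cases "c \<in> A")
  case True
  then have "sym_diff A {c} = A - {c}" and "card A = Suc (card (A - {c}))"
    using assms card.remove by fastforce+
  then show ?thesis by simp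
next
  case False
  then have "sym_diff A {c} = insert c A" by auto
  then show ?thesis using False assms by simp
qed

text \<open>
  The condition \<open>stable\<close> makes toggling \<open>t A\<close> an involution of \<open>\<S>\<close>; as it flips the sign of
  each term, the sum equals its own negative.
\<close>

lemma sum_sign_toggle_eq_0:
  fixes t :: "'a set \<Rightarrow> 'a"
  assumes fin: "\<And>A. A \<in> \<S> \<Longrightarrow> finite A"
    and closed: "\<And>A. A \<in> \<S> \<Longrightarrow> sym_diff A {t A} \<in> \<S>"
    and stable: "\<And>A. A \<in> \<S> \<Longrightarrow> t (sym_diff A {t A}) = t A"
  shows "(\<Sum>A\<in>\<S>. (-1 :: int) ^ card A) = 0"
proof -
  define g where "g A = sym_diff A {t A}" for A
  have invol: "g (g A) = A" if "A \<in> \<S>" for A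
    using stable[OF that] unfolding g_def by auto
  have "(\<Sum>A\<in>\<S>. (-1 :: int) ^ card A) = (\<Sum>A\<in>\<S>. (-1) ^ card (g A))"
    by (rule sum.reindex_bij_witness[of _ g g]) (use invol closed in \<open>auto simp: g_def\<close>)
  also have "\<dots> = - (\<Sum>A\<in>\<S>. (-1) ^ card A)"
    using fin by (simp add: g_def power_minus_one_card_toggle flip: sum_negf)
  finally show ?thesis by simp
qed

lemma sum_sign_Pow:
  assumes "finite S"
  shows "(\<Sum>A\<in>Pow S. (-1 :: int) ^ card A) = (if S = {} then 1 else 0)"
proof (cases "S = {}")
  case False
  then obtain s where "s \<in> S" by blast
  then have "(\<Sum>A\<in>Pow S. (-1 :: int) ^ card A) = 0"
    using assms by (intro sum_sign_toggle_eq_0[where t = "\<lambda>_. s"]) (auto intro: finite_subset)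
  then show ?thesis using False by simp
qed simp

section \<open>Crosscuts and maximal chains\<close>

lemma chain_less_iff:
  "pred_on.chain UNIV (<) S \<longleftrightarrow> (\<forall>x\<in>S. \<forall>y\<in>S. x \<le> y \<or> y \<le> (x :: 'a::order))"
  unfolding pred_on.chain_def by (simp add: le_less[where 'a = 'a])

lemma ex_maxchain_superset:
  fixes S :: "'a::{finite, order} set"
  assumes "pred_on.chain UNIV (<) S"
  shows "\<exists>K. pred_on.maxchain UNIV (<) K \<and> S \<subseteq> K"
proof -
  obtain K where "S \<subseteq> K" and "pred_on.chain UNIV (<) K"
    and "\<And>K'. pred_on.chain UNIV (<) K' \<Longrightarrow> K \<subseteq> K' \<Longrightarrow> K' = K"
    using finite_has_maximal2[of "{K. pred_on.chain UNIV (<) K}" S] assms by auto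
  then show ?thesis unfolding pred_on.maxchain_def by blast
qed

lemma crosscut_interval_cases:
  fixes C :: "'a::{finite, bounded_lattice} set"
  assumes "crosscut C" and "y \<le> z"
  shows "\<exists>c\<in>C. c < y \<or> (y \<le> c \<and> c \<le> z) \<or> z < c"
proof -
  have "pred_on.chain UNIV (<) {y, z}"
    using assms(2) by (auto simp: chain_less_iff)
  then obtain K where K: "pred_on.maxchain UNIV (<) K" "{y, z} \<subseteq> K"
    using ex_maxchain_superset by blast
  then obtain c where "c \<in> C" "c \<in> K"
    using assms(1) unfolding crosscut_def by blast
  moreover have "pred_on.chain UNIV (<) K"
    using K(1) unfolding pred_on.maxchain_def by blast
  ultimately show ?thesis
    using K(2) unfolding chain_less_iff by (metis insert_subset order_le_less)
qed

text \<open>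
  The three positions of a crosscut element relative to an interval exclude each other, because
  two of them would give comparable distinct elements of \<open>C\<close>; hence the indicators add up to \<open>1\<close>.
\<close>

lemma crosscut_interval_indicator:
  fixes C :: "'a::{finite, bounded_lattice} set"
  assumes "crosscut C" and "y \<le> z"
  shows "(if \<exists>c\<in>C. y \<le> c \<and> c \<le> z then 1 else 0 :: int) =
    1 - (if \<exists>c\<in>C. z < c then 1 else 0) - (if \<exists>c\<in>C. c < y then 1 else 0)"
proof -
  have anti: "\<not> c < c'" if "c \<in> C" "c' \<in> C" for c c'
    using assms(1) that unfolding crosscut_def antichain_def by fastforce
  have "\<not> ((\<exists>c\<in>C. z < c) \<and> (\<exists>c\<in>C. c < y))"
    by (meson anti assms(2) order_less_le_trans order_less_trans)
  moreover have "\<not> ((\<exists>c\<in>C. y \<le> c \<and> c \<le> z) \<and> (\<exists>c\<in>C. z < c))"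
    by (meson anti order_le_less_trans)
  moreover have "\<not> ((\<exists>c\<in>C. y \<le> c \<and> c \<le> z) \<and> (\<exists>c\<in>C. c < y))"
    by (meson anti order_less_le_trans)
  ultimately show ?thesis
    using crosscut_interval_cases[OF assms] by auto
qed

section \<open>The crosscut theorem\<close>

text \<open>
  The values of the Moebius function of the reversed order, that is, \<open>\<mu>(x, top)\<close>, obtained by
  recursion downwards from \<open>top\<close>.
\<close>

lemma ex_dual_mobius:
  "\<exists>m :: 'a::{finite, order_top} \<Rightarrow> int. \<forall>x. (\<Sum>y | x \<le> y. m y) = (if x = top then 1 else 0)"
proof -
  define R :: "('a \<times> 'a) set" where "R = {(y, x). x < y}"
  have wf: "wf R"
    by (rule wf_subset[of "measure (\<lambda>x. card {y. x < y})"])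
       (auto simp: R_def intro!: psubset_card_mono)
  define m :: "'a \<Rightarrow> int" where
    "m = wfrec R (\<lambda>g x. (if x = top then 1 else 0) - (\<Sum>y | x < y. g y))"
  have rec: "m x = (if x = top then 1 else 0) - (\<Sum>y | x < y. m y)" for x
    unfolding m_def by (subst wfrec[OF wf]) (simp add: R_def cut_apply)
  have "(\<Sum>y | x \<le> y. m y) = m x + (\<Sum>y | x < y. m y)" for x
  proof -
    have "{y. x \<le> y} = insert x {y. x < y}" by auto
    then show ?thesis by simp
  qed
  then show ?thesis by (intro exI[of _ m]) (metis rec diff_add_cancel)
qed

theorem crosscut_theorem:
  fixes C :: "'a::{finite, complete_lattice} set"
  assumes nontrivial: "(bot :: 'a) \<noteq> top" and C: "crosscut C"
  shows "mobius (top :: 'a) = (\<Sum>A | A \<subseteq> C \<and> Inf A = bot \<and> Sup A = top. (-1) ^ card A)"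
proof -
  obtain m :: "'a \<Rightarrow> int" where m: "\<And>x. (\<Sum>y | x \<le> y. m y) = (if x = top then 1 else 0)"
    using ex_dual_mobius by blast
  define D :: "'a \<Rightarrow> int" where "D z = (if \<exists>c\<in>C. z < c then 1 else 0)" for z
  define U :: "'a \<Rightarrow> int" where "U y = (if \<exists>c\<in>C. c < y then 1 else 0)" for y
  define w where "w y z = mobius y * m z" for y z :: 'a
  have C_proper: "C \<subseteq> UNIV - {bot, top}" using C unfolding crosscut_def by blast
  obtain c0 where c0: "c0 \<in> C"
    using crosscut_interval_cases[OF C, of bot bot] by auto
  have bot_below: "\<exists>c\<in>C. bot < c" and top_above: "\<exists>c\<in>C. c < top"
    using c0 C_proper by (auto simp: bot_less less_top[symmetric] intro!: bexI[of _ c0])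

  have inner: "(\<Sum>A | A \<subseteq> C \<and> y \<le> Inf A \<and> Sup A \<le> z. (-1 :: int) ^ card A) =
      1 - (if \<exists>c\<in>C. y \<le> c \<and> c \<le> z then 1 else 0)" for y z
  proof -
    have "{A. A \<subseteq> C \<and> y \<le> Inf A \<and> Sup A \<le> z} = Pow {c \<in> C. y \<le> c \<and> c \<le> z}"
      by (auto simp: le_Inf_iff Sup_le_iff)
    then show ?thesis by (auto simp: sum_sign_Pow)
  qed

  have "(\<Sum>A | A \<subseteq> C \<and> Inf A = bot \<and> Sup A = top. (-1 :: int) ^ card A) =
      (\<Sum>A\<in>Pow C. (if Inf A = bot then 1 else 0) * (if Sup A = top then 1 else 0) * (-1) ^ card A)"
    by (rule sum.mono_neutral_cong_left) auto
  also have "\<dots> = (\<Sum>A\<in>Pow C. \<Sum>y\<in>UNIV. \<Sum>z\<in>UNIV.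
      if y \<le> Inf A \<and> Sup A \<le> z then w y z * (-1) ^ card A else 0)"
  proof (rule sum.cong[OF refl])
    fix A :: "'a set"
    have "(if Inf A = bot then 1 else 0) * (if Sup A = top then 1 else 0) * (-1 :: int) ^ card A =
        (\<Sum>y\<in>UNIV. if y \<le> Inf A then mobius y else 0) *
        (\<Sum>z\<in>UNIV. if Sup A \<le> z then m z else 0) * (-1) ^ card A"
      using sum_mobius[of "Inf A"] m[of "Sup A"] by (simp add: sum.If_cases)
    also have "\<dots> = (\<Sum>y\<in>UNIV. \<Sum>z\<in>UNIV.
        if y \<le> Inf A \<and> Sup A \<le> z then w y z * (-1) ^ card A else 0)"
      unfolding sum_product unfolding sum_distrib_right
      by (intro sum.cong refl) (simp add: w_def)
    finally show "(if Inf A = bot then 1 else 0) * (if Sup A = top then 1 else 0) *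
        (-1 :: int) ^ card A = \<dots>" .
  qed
  also have "\<dots> = (\<Sum>y\<in>UNIV. \<Sum>z\<in>UNIV. \<Sum>A\<in>Pow C.
      if y \<le> Inf A \<and> Sup A \<le> z then w y z * (-1) ^ card A else 0)"
    by (subst sum.swap, intro sum.cong refl, rule sum.swap)
  also have "\<dots> = (\<Sum>y\<in>UNIV. \<Sum>z\<in>UNIV.
      w y z * (1 - (if \<exists>c\<in>C. y \<le> c \<and> c \<le> z then 1 else 0)))"
    unfolding inner[symmetric] sum_distrib_left
    by (intro sum.cong refl sum.mono_neutral_cong_right) auto
  also have "\<dots> = (\<Sum>y\<in>UNIV. \<Sum>z\<in>UNIV. w y z) -
      (\<Sum>y\<in>UNIV. \<Sum>z\<in>UNIV. if y \<le> z then w y z * (1 - D z - U y) else 0)"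
    unfolding sum_subtractf[symmetric]
  proof (intro sum.cong refl)
    fix y z
    show "w y z * (1 - (if \<exists>c\<in>C. y \<le> c \<and> c \<le> z then 1 else 0)) =
        w y z - (if y \<le> z then w y z * (1 - D z - U y) else 0)"
    proof (cases "y \<le> z")
      case True
      show ?thesis
        using crosscut_interval_indicator[OF C True] True
        unfolding D_def U_def by (simp only: if_True) (simp add: algebra_simps)
    next
      case False
      then have "\<not> (\<exists>c\<in>C. y \<le> c \<and> c \<le> z)" using order_trans by blast
      then show ?thesis using False by (simp only: if_False) simp
    qed
  qed
  also have "(\<Sum>y\<in>UNIV. \<Sum>z\<in>UNIV. w y z) = 0"
  proof -
    have "(\<Sum>y\<in>UNIV. mobius (y :: 'a)) = 0"
      using sum_mobius[of "top :: 'a"] nontrivial by auto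
    then show ?thesis by (simp add: w_def flip: sum_product)
  qed
  also have "(\<Sum>y\<in>UNIV. \<Sum>z\<in>UNIV. if y \<le> z then w y z * (1 - D z - U y) else 0) =
      (\<Sum>z\<in>UNIV. \<Sum>y\<in>UNIV. if y \<le> z then w y z * (1 - D z) else 0) -
      (\<Sum>y\<in>UNIV. \<Sum>z\<in>UNIV. if y \<le> z then w y z * U y else 0)"
    by (subst (2) sum.swap, unfold sum_subtractf[symmetric], intro sum.cong refl)
       (simp add: algebra_simps)
  also have "(\<Sum>z\<in>UNIV. \<Sum>y\<in>UNIV. if y \<le> z then w y z * (1 - D z) else 0) = 0"
  proof (rule sum.neutral, rule ballI)
    fix z :: 'a
    have "(\<Sum>y\<in>UNIV. if y \<le> z then w y z * (1 - D z) else 0) =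
        (\<Sum>y | y \<le> z. mobius y) * (m z * (if \<exists>c\<in>C. z < c then 0 else 1))"
      unfolding sum_distrib_right
      by (rule sum.mono_neutral_cong_right) (auto simp: w_def D_def)
    also have "\<dots> = 0" using bot_below by (auto simp: sum_mobius)
    finally show "(\<Sum>y\<in>UNIV. if y \<le> z then w y z * (1 - D z) else 0) = 0" .
  qed
  also have "(\<Sum>y\<in>UNIV. \<Sum>z\<in>UNIV. if y \<le> z then w y z * U y else 0) = mobius (top :: 'a)"
  proof -
    have "(\<Sum>z\<in>UNIV. if y \<le> z then w y z * U y else 0) =
        (if y = top then mobius y else 0)" for y
    proof -
      have "(\<Sum>z\<in>UNIV. if y \<le> z then w y z * U y else 0) =
          (mobius y * (if \<exists>c\<in>C. c < y then 1 else 0)) * (\<Sum>z | y \<le> z. m z)"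
        unfolding sum_distrib_left
        by (rule sum.mono_neutral_cong_right) (auto simp: w_def U_def)
      also have "\<dots> = (if y = top then mobius y else 0)" using top_above by (auto simp: m)
      finally show ?thesis .
    qed
    then show ?thesis by simp
  qed
  finally show ?thesis by simp
qed

section \<open>Cancellation of the sets that contain a broken set\<close>

text \<open>
  The number of predecessors serves as the rank.  A ranked comparison replaces the partial
  order because a bound by all of \<open>B\<close> at once is needed: the witness for an element of \<open>B\<close> of
  least rank lies below every element of \<open>B\<close> in rank, and in particular outside \<open>B\<close>.
\<close>

lemma partial_order_rank_less:
  fixes r :: "('a::finite \<times> 'a) set"
  assumes "partial_order_on C r" and "(c, b) \<in> r - Id"
  shows "card {x. (x, c) \<in> r} < card {x. (x, b) \<in> r}"
proof (rule psubset_card_mono)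
  have "trans r" and "antisym r" and "refl_on C r" and "r \<subseteq> C \<times> C"
    using assms(1) unfolding partial_order_on_def preorder_on_def by auto
  then have "(b, b) \<in> r" and "(b, c) \<notin> r"
    using assms(2) by (auto dest: refl_onD antisymD)
  then show "{x. (x, c) \<in> r} \<subset> {x. (x, b) \<in> r}"
    using assms(2) \<open>trans r\<close> by (auto dest: transD)
qed simp

lemma broken_set_rank_witness:
  fixes C :: "'a::{finite, complete_lattice} set" and h :: "'a \<Rightarrow> nat"
  assumes h: "\<And>b c. (c, b) \<in> r - Id \<Longrightarrow> h c < h b" and B: "B \<in> broken_sets C r"
  shows "\<exists>c\<in>C. (\<forall>b\<in>B. h c < h b) \<and> Inf B < c \<and> c < Sup B"
proof -
  have "B \<noteq> {}" using B unfolding broken_sets_def by blast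
  then obtain b where b: "b \<in> B" "\<And>b'. b' \<in> B \<Longrightarrow> h b \<le> h b'"
    by (metis arg_min_least arg_min_if_finite(1) finite)
  then obtain c where "c \<in> C" "(c, b) \<in> r - Id" "Inf B < c" "c < Sup B"
    using B unfolding broken_sets_def by blast
  then show ?thesis using b(2) h[of c b] by (auto intro!: bexI[of _ c] intro: less_le_trans)
qed

text \<open>
  Elements of equal rank are not compared: the toggled element is an arbitrary but fixed choice
  from the set \<open>M A\<close> of candidates of largest rank.  This is consistent since toggling leaves
  \<open>M A\<close> as a whole unchanged.
\<close>

lemma sum_sign_containing_broken_set:
  fixes C :: "'a::{finite, complete_lattice} set" and h :: "'a \<Rightarrow> nat"
  assumes witness: "\<And>B. B \<in> \<B> \<Longrightarrow> \<exists>c\<in>C. (\<forall>b\<in>B. h c < h b) \<and> Inf B < c \<and> c < Sup B"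
  shows "(\<Sum>A | A \<subseteq> C \<and> Inf A = bot \<and> Sup A = top \<and> (\<exists>B\<in>\<B>. B \<subseteq> A). (-1 :: int) ^ card A) = 0"
    (is "sum _ ?\<S> = 0")
proof -
  define W where "W B c \<longleftrightarrow> c \<in> C \<and> (\<forall>b\<in>B. h c < h b) \<and> Inf B < c \<and> c < Sup B" for B c
  define cand where "cand A = {c. \<exists>B\<in>\<B>. B \<subseteq> A \<and> W B c}" for A
  define M where "M A = {c \<in> cand A. \<forall>c'\<in>cand A. h c' \<le> h c}" for A
  define t where "t A = (SOME c. c \<in> M A)" for A
  have t: "t A \<in> M A" if "A \<in> ?\<S>" for A
  proof -
    from that obtain B where "B \<in> \<B>" "B \<subseteq> A" by blast
    then obtain c where c: "c \<in> cand A"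
      using witness[of B] unfolding cand_def W_def by auto
    have "finite (h ` cand A)" "h ` cand A \<noteq> {}" using c by auto
    then obtain d where "d \<in> cand A" "h d = Max (h ` cand A)"
      by (metis (no_types, lifting) Max_in imageE)
    then have "d \<in> M A" unfolding M_def by simp
    then show ?thesis unfolding t_def by (rule someI)
  qed
  have M_toggle: "M (sym_diff A {c}) = M A" if c: "c \<in> M A" for A c
  proof -
    \<comment> \<open>A set \<open>B\<close> inside only one of \<open>A\<close> and its toggle contains \<open>c\<close>, so all its witnesses have
      smaller rank than \<open>c\<close>.\<close>
    have "d \<in> cand A \<longleftrightarrow> d \<in> cand (sym_diff A {c})" if "h c \<le> h d" for d
    proof -
      have "c \<notin> B" if "W B d" for B
        using that \<open>h c \<le> h d\<close> unfolding W_def by force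
      then show ?thesis unfolding cand_def by blast
    qed
    then have "c \<in> cand (sym_diff A {c})"
      and "\<And>d. h c \<le> h d \<Longrightarrow> d \<in> cand A \<longleftrightarrow> d \<in> cand (sym_diff A {c})"
      using c unfolding M_def by auto
    then show ?thesis
      using c unfolding M_def by (auto; metis linorder_le_cases order_trans)
  qed
  show ?thesis
  proof (rule sum_sign_toggle_eq_0[where t = t])
    fix A assume A: "A \<in> ?\<S>"
    show "t (sym_diff A {t A}) = t A"
      using M_toggle[OF t[OF A]] unfolding t_def by simp
    obtain B where B: "B \<in> \<B>" "B \<subseteq> A" "W B (t A)"
      using t[OF A] unfolding M_def cand_def by blast
    let ?c = "t A" and ?A' = "sym_diff A {t A}"
    have "?c \<notin> B" using B(3) unfolding W_def by blast
    then have B': "B \<subseteq> ?A'" using B(2) by blast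
    have "?c \<in> C" and "Inf B \<le> ?c" and "?c \<le> Sup B"
      using B(3) unfolding W_def by auto
    then have "Inf (insert ?c S) = Inf S" "Sup (insert ?c S) = Sup S" if "B \<subseteq> S" for S
      using Inf_superset_mono[OF that] Sup_subset_mono[OF that]
      by (auto simp: inf_absorb2 sup_absorb2)
    moreover have "insert ?c ?A' = insert ?c A" by blast
    ultimately have "Inf ?A' = Inf A" "Sup ?A' = Sup A"
      using B(2) B' by metis+
    then show "?A' \<in> ?\<S>"
      using A \<open>?c \<in> C\<close> B(1) B' by auto
  qed simp
qed

section \<open>The identity\<close>

theorem mainTheorem6:
  fixes C :: "'a::{finite, complete_lattice} set" and r :: "('a \<times> 'a) set"
  assumes "(UNIV :: 'a set) - {bot, top} \<noteq> {}"
    and "crosscut C"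
    and "partial_order_on C r"
  shows "mobius (top :: 'a) =
           (\<Sum>A | A \<subseteq> C \<and> Inf A = bot \<and> Sup A = top \<and>
                (\<forall>B \<in> broken_sets C r. \<not> B \<subseteq> A). (-1) ^ card A)
     \<and> (\<forall>\<B>' \<subseteq> broken_sets C r.
           mobius (top :: 'a) =
           (\<Sum>A | A \<subseteq> C \<and> Inf A = bot \<and> Sup A = top \<and>
                (\<forall>B \<in> \<B>'. \<not> B \<subseteq> A). (-1) ^ card A))"
proof -
  have nontrivial: "(bot :: 'a) \<noteq> top"
    using assms(1) by (metis Diff_eq_empty_iff bot_least insertI1 order_antisym subsetI top_greatest)
  have main: "mobius (top :: 'a) =
      (\<Sum>A | A \<subseteq> C \<and> Inf A = bot \<and> Sup A = top \<and> (\<forall>B \<in> \<B>. \<not> B \<subseteq> A). (-1) ^ card A)"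
    (is "_ = sum ?s ?good")
    if \<B>: "\<B> \<subseteq> broken_sets C r" for \<B>
  proof -
    let ?bad = "{A. A \<subseteq> C \<and> Inf A = bot \<and> Sup A = top \<and> (\<exists>B\<in>\<B>. B \<subseteq> A)}"
    have "{A. A \<subseteq> C \<and> Inf A = bot \<and> Sup A = top} = ?good \<union> ?bad" by blast
    then have "mobius (top :: 'a) = sum ?s (?good \<union> ?bad)"
      using crosscut_theorem[OF nontrivial assms(2)] by simp
    also have "\<dots> = sum ?s ?good + sum ?s ?bad"
      by (rule sum.union_disjoint) auto
    also have "sum ?s ?bad = 0"
    proof (rule sum_sign_containing_broken_set)
      fix B assume "B \<in> \<B>"
      then show "\<exists>c\<in>C. (\<forall>b\<in>B. card {x. (x, c) \<in> r} < card {x. (x, b) \<in> r}) \<and>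
          Inf B < c \<and> c < Sup B"
        using \<B> partial_order_rank_less[OF assms(3)]
        by (intro broken_set_rank_witness[where r = r]) auto
    qed
    finally show ?thesis by simp
  qed
  then show ?thesis by blast
qed

end
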